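(* Every partition matroid satisfies White's conjecture.
   Context: A matroid $M$ is a finite ground set $\mathcal{E}_M$ with a non-empty family $\mathcal{B}_M$ of bases satisfying the exchange property. A partition matroid of rank $t$ is a matroid $M(\mathcal{P})$ associated with a partition $\mathcal{P}=\{A_1,\ldots,A_m\}$ of its finite ground set $\mathcal{E}$ into non-empty parts (with $t\le m$), whose basis set is $\{U\subseteq\mathcal{E}:|U\cap A_i|\le 1\text{ for all }i\text{ and }|U|=t\}$. Two sequences of bases $(A_1,\ldots,A_m)$ and $(B_1,\ldots,B_m)$ of a matroid $M$ are compatible if $A_1\cup\cdots\cup A_m=B_1\cup\cdots\cup B_m$ as multisets. Let $1\le r<s\le m$. If $x\in A_r$ and $y\in A_s$ are such that $(A_r\setminus x)\cup y$ and $(A_s\setminus y)\cup x$ are both bases, then replacing $A_r$ by $(A_r\setminus x)\cup y$ and $A_s$ by $(A_s\setminus y)\cup x$ in $(A_1,\ldots,A_m)$ is a symmetric exchange. If $U\subseteq A_r$ and $V\subseteq A_s$ are such that $(A_r\setminus U)\cup V$ and $(A_s\setminus V)\cup U$ are both bases, then replacing $A_r$ by $(A_r\setminus U)\cup V$ and $A_s$ by $(A_s\setminus V)\cup U$ is a symmetric subset exchange. Write $\sim^1_M$ for the relation "is obtained by a symmetric exchange", $\sim^2_M$ for "is obtained by a symmetric exchange or by a permutation of the order of the bases", and $\sim^3_M$ for "is obtained by a symmetric subset exchange". For $i=1,2,3$, $\mathrm{TE}(i)$ is the class of matroids $M$ such that, for every $m\ge 1$, any two compatible sequences of $m$ bases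 of $M$ are connected by a finite (possibly empty) chain of $\sim^i_M$ steps through sequences of $m$ bases of $M$. A matroid $M$ satisfies White's conjecture if $M\in\mathrm{TE}(i)$ for all $i=1,2,3$. *)

theory Defs
  imports "HOL-Library.Multiset" "HOL-Library.Disjoint_Sets"
begin

record 'a matroid =
  ground :: "'a set"
  bases :: "'a set set"

definition is_matroid :: "'a matroid \<Rightarrow> bool" where
  "is_matroid M \<longleftrightarrow>
     finite (ground M) \<and> bases M \<subseteq> Pow (ground M) \<and> bases M \<noteq> {} \<and>
     (\<forall>A \<in> bases M. \<forall>B \<in> bases M. \<forall>x \<in> A - B. \<exists>y \<in> B - A. (A - {x}) \<union> {y} \<in> bases M)"

definition partition_matroid :: "'a set \<Rightarrow> 'a set set \<Rightarrow> nat \<Rightarrow> 'a matroid" where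
  "partition_matroid E P t =
     \<lparr>ground = E, bases = {U. U \<subseteq> E \<and> (\<forall>A \<in> P. card (U \<inter> A) \<le> 1) \<and> card U = t}\<rparr>"

definition basis_seq :: "'a matroid \<Rightarrow> nat \<Rightarrow> 'a set list \<Rightarrow> bool" where
  "basis_seq M m As \<longleftrightarrow> length As = m \<and> set As \<subseteq> bases M"

text \<open>
  The union as multisets adds multiplicities. As \<open>mset_set\<close> of an infinite set is empty,
  this is meaningful only for finite sets, such as the bases of a matroid.
\<close>

definition compatible :: "'a set list \<Rightarrow> 'a set list \<Rightarrow> bool" where
  "compatible As Bs \<longleftrightarrow> sum_list (map mset_set As) = sum_list (map mset_set Bs)"

definition sym_exchange :: "'a matroid \<Rightarrow> 'a set list \<Rightarrow> 'a set list \<Rightarrow> bool" where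
  "sym_exchange M As Bs \<longleftrightarrow>
     (\<exists>r s x y. r < s \<and> s < length As \<and> x \<in> As ! r \<and> y \<in> As ! s \<and>
        (As ! r - {x}) \<union> {y} \<in> bases M \<and> (As ! s - {y}) \<union> {x} \<in> bases M \<and>
        Bs = As[r := (As ! r - {x}) \<union> {y}, s := (As ! s - {y}) \<union> {x}])"

definition sym_subset_exchange :: "'a matroid \<Rightarrow> 'a set list \<Rightarrow> 'a set list \<Rightarrow> bool" where
  "sym_subset_exchange M As Bs \<longleftrightarrow>
     (\<exists>r s U V. r < s \<and> s < length As \<and> U \<subseteq> As ! r \<and> V \<subseteq> As ! s \<and>
        (As ! r - U) \<union> V \<in> bases M \<and> (As ! s - V) \<union> U \<in> bases M \<and>
        Bs = As[r := (As ! r - U) \<union> V, s := (As ! s - V) \<union> U])"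

text \<open>
  The relations $\sim^i_M$ for $i = 1, 2, 3$ (empty for any other index). Equality of
  \<open>mset\<close> says that one list is a permutation of the other.
\<close>

definition exchange_step :: "nat \<Rightarrow> 'a matroid \<Rightarrow> 'a set list \<Rightarrow> 'a set list \<Rightarrow> bool" where
  "exchange_step i M As Bs \<longleftrightarrow>
     (i = 1 \<and> sym_exchange M As Bs) \<or>
     (i = 2 \<and> (sym_exchange M As Bs \<or> mset As = mset Bs)) \<or>
     (i = 3 \<and> sym_subset_exchange M As Bs)"

definition TE :: "nat \<Rightarrow> 'a matroid set" where
  "TE i = {M. is_matroid M \<and>
     (\<forall>m \<ge> 1. \<forall>As Bs. basis_seq M m As \<and> basis_seq M m Bs \<and> compatible As Bs \<longrightarrow>
        (\<lambda>Xs Ys. basis_seq M m Xs \<and> basis_seq M m Ys \<and> exchange_step i M Xs Ys)\<^sup>*\<^sup>* As Bs)}"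

definition satisfies_White :: "'a matroid \<Rightarrow> bool" where
  "satisfies_White M \<longleftrightarrow> (\<forall>i \<in> {1, 2, 3}. M \<in> TE i)"

end

theory Submission
  imports Defs
begin

text \<open>
  Let \<open>c\<close> send an element to its part, so that the bases are the \<open>t\<close>-sets on which \<open>c\<close> is
  injective. A single exchange is also a subset exchange, so only \<open>TE 1\<close> matters. Given compatible
  sequences \<open>A\<close> and \<open>B\<close>, exchanges in \<open>A\<close> and in \<open>B\<close> first make the sequences of images
  \<open>a\<^sub>i = c ` A\<^sub>i\<close> and \<open>b\<^sub>i = c ` B\<^sub>i\<close> equal. If they differ, choose \<open>r\<close> with \<open>|a\<^sub>r - b\<^sub>r|\<close> positive and
  minimal, a part \<open>i \<in> a\<^sub>r - b\<^sub>r\<close>, and by compatibility an index \<open>s\<close> with \<open>i \<in> b\<^sub>s - a\<^sub>s\<close>. As \<open>i\<close>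
  lies in \<open>a\<^sub>r - b\<^sub>r\<close> but not in \<open>a\<^sub>s - b\<^sub>s\<close>, minimality yields \<open>k \<in> a\<^sub>s - b\<^sub>s\<close> outside \<open>a\<^sub>r - b\<^sub>r\<close>. If
  \<open>k \<notin> a\<^sub>r\<close>, exchanging \<open>i\<close> and \<open>k\<close> between \<open>A\<^sub>r\<close> and \<open>A\<^sub>s\<close> brings the image sequences closer, and
  otherwise \<open>k \<in> b\<^sub>r\<close> and exchanging them between \<open>B\<^sub>r\<close> and \<open>B\<^sub>s\<close> does. Once the images agree,
  exchanges within single parts turn \<open>A\<close> into \<open>B\<close>.
\<close>

section \<open>Exchanges in sequences of sets and the distance between two sequences\<close>

definition swap :: "nat \<Rightarrow> nat \<Rightarrow> 'a \<Rightarrow> 'a \<Rightarrow> 'a set list \<Rightarrow> 'a set list" where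
  "swap r s x y Xs = Xs[r := (Xs ! r - {x}) \<union> {y}, s := (Xs ! s - {y}) \<union> {x}]"

text \<open>For finite sets of equal size the one-sided difference has half the size of the
  symmetric one, so it suffices as an induction measure.\<close>

definition seq_dist :: "'a set list \<Rightarrow> 'a set list \<Rightarrow> nat" where
  "seq_dist Xs Ys = (\<Sum>i<length Xs. card (Xs ! i - Ys ! i))"

lemma length_swap [simp]: "length (swap r s x y Xs) = length Xs"
  by (simp add: swap_def)

lemma nth_swap:
  assumes "r \<noteq> s" "r < length Xs" "s < length Xs"
  shows "swap r s x y Xs ! r = (Xs ! r - {x}) \<union> {y}"
    and "swap r s x y Xs ! s = (Xs ! s - {y}) \<union> {x}"
    and "i \<noteq> r \<Longrightarrow> i \<noteq> s \<Longrightarrow> swap r s x y Xs ! i = Xs ! i"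
  using assms by (auto simp: swap_def)

lemma swap_commute: "r \<noteq> s \<Longrightarrow> swap r s x y Xs = swap s r y x Xs"
  by (simp add: swap_def list_update_swap)

section \<open>Index sums and compatibility\<close>

lemma sum_split_two:
  fixes f :: "nat \<Rightarrow> 'b::comm_monoid_add"
  assumes "r \<noteq> s" "r < n" "s < n"
  shows "(\<Sum>i<n. f i) = f r + f s + (\<Sum>i\<in>{..<n} - {r, s}. f i)"
proof -
  have "(\<Sum>i<n. f i) = (\<Sum>i\<in>{r, s}. f i) + (\<Sum>i\<in>{..<n} - {r, s}. f i)"
    using assms by (subst add.commute, intro sum.subset_diff) auto
  then show ?thesis using assms(1) by simp
qed

text \<open>As \<open>x\<close> is new to \<open>Xs ! s\<close> and \<open>y\<close> is new to
  \<open>Xs ! r\<close>, neither insertion merges two copies, so the multiset sum of the two entries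
  survives.\<close>

lemma compatible_swap:
  assumes "r \<noteq> s" "r < length Xs" "s < length Xs"
    and "finite (Xs ! r)" "finite (Xs ! s)"
    and "x \<in> Xs ! r - Xs ! s" "y \<in> Xs ! s - Xs ! r"
  shows "compatible Xs (swap r s x y Xs)"
proof -
  let ?Ys = "swap r s x y Xs"
  have 1: "mset_set (?Ys ! r) + mset_set (?Ys ! s) = mset_set (Xs ! r) + mset_set (Xs ! s)"
    using assms by (auto simp: nth_swap mset_set.remove[of _ x] mset_set.remove[of _ y])
  have 2: "(\<Sum>i\<in>{..<length Xs} - {r, s}. mset_set (?Ys ! i))
      = (\<Sum>i\<in>{..<length Xs} - {r, s}. mset_set (Xs ! i))"
    by (rule sum.cong) (use assms in \<open>auto simp: nth_swap\<close>)
  have "sum_list (map mset_set Zs) = (\<Sum>i<length Zs. mset_set (Zs ! i))" for Zs :: "'a set list"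
    by (simp add: sum_list_sum_nth atLeast0LessThan)
  then show ?thesis
    unfolding compatible_def
    using 1 2 sum_split_two[OF assms(1-3), of "\<lambda>i. mset_set (?Ys ! i)"]
      sum_split_two[OF assms(1-3), of "\<lambda>i. mset_set (Xs ! i)"] by simp
qed

lemma compatible_sym: "compatible Xs Ys \<Longrightarrow> compatible Ys Xs"
  by (simp add: compatible_def)

lemma compatible_trans: "compatible Xs Ys \<Longrightarrow> compatible Ys Zs \<Longrightarrow> compatible Xs Zs"
  by (simp add: compatible_def)

lemma compatible_image:
  assumes "compatible Xs Ys" and "\<And>X. X \<in> set Xs \<union> set Ys \<Longrightarrow> inj_on c X"
  shows "compatible (map (image c) Xs) (map (image c) Ys)"
proof -
  have "sum_list (map mset_set (map (image c) Zs)) = image_mset c (sum_list (map mset_set Zs))"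
    if "\<And>Z. Z \<in> set Zs \<Longrightarrow> inj_on c Z" for Zs
    using that by (induction Zs) (auto simp: image_mset_mset_set)
  with assms show ?thesis by (simp add: compatible_def)
qed

text \<open>Both sequences have equally many entries containing \<open>x\<close>. If every entry of
  \<open>Ys\<close> with \<open>x\<close> faced an entry of \<open>Xs\<close> with \<open>x\<close>,
  the index \<open>r\<close> would make the count for \<open>Xs\<close> strictly larger.\<close>

lemma compatible_obtain:
  assumes "compatible Xs Ys" "length Xs = length Ys"
    and fin: "\<And>X. X \<in> set Xs \<union> set Ys \<Longrightarrow> finite X"
    and r: "r < length Xs" "x \<in> Xs ! r - Ys ! r"
  obtains s where "s < length Xs" "x \<in> Ys ! s - Xs ! s"
proof -
  have cnt: "count (sum_list (map mset_set Zs)) x = (\<Sum>i<length Zs. of_bool (x \<in> Zs ! i))"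
    if "\<And>Z. Z \<in> set Zs \<Longrightarrow> finite Z" for Zs
  proof -
    have "count (sum_list (map mset_set Zs)) x = (\<Sum>i<length Zs. count (mset_set (Zs ! i)) x)"
      by (simp add: sum_list_sum_nth atLeast0LessThan count_sum)
    also have "\<dots> = (\<Sum>i<length Zs. of_bool (x \<in> Zs ! i))"
      using that by (intro sum.cong) (auto simp: count_mset_set')
    finally show ?thesis .
  qed
  have eq: "(\<Sum>i<length Xs. of_bool (x \<in> Xs ! i)) = (\<Sum>i<length Xs. of_bool (x \<in> Ys ! i) :: nat)"
    using cnt[of Xs] cnt[of Ys] fin assms(1,2) by (simp add: compatible_def)
  have "\<exists>s<length Xs. x \<in> Ys ! s - Xs ! s"
  proof (rule ccontr)
    assume no: "\<not> ?thesis"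
    have "(\<Sum>i<length Xs. of_bool (x \<in> Ys ! i)) < (\<Sum>i<length Xs. of_bool (x \<in> Xs ! i) :: nat)"
      by (rule sum_strict_mono_ex1) (use no r in auto)
    with eq show False by simp
  qed
  then show ?thesis using that by blast
qed

section \<open>The effect of an exchange on the distance\<close>

lemma card_exchange_diff:
  assumes "finite X" "x \<in> X" "y \<notin> X"
  shows "card ((X - {x}) \<union> {y} - Y) + of_bool (x \<notin> Y) = card (X - Y) + of_bool (y \<notin> Y)"
proof -
  have "(X - {x}) \<union> {y} - Y = (if y \<in> Y then X - Y - {x} else insert y (X - Y - {x}))"
    by auto
  moreover have "card (X - Y - {x}) + of_bool (x \<notin> Y) = card (X - Y)"
    using assms card_Suc_Diff1[of "X - Y" x] by (cases "x \<in> Y") auto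
  ultimately show ?thesis using assms by auto
qed

text \<open>In the last hypothesis the left side counts the mismatches that the exchange creates and
  the right side those that it removes.\<close>

lemma seq_dist_swap:
  assumes "r \<noteq> s" "r < length Xs" "s < length Xs"
    and "finite (Xs ! r)" "finite (Xs ! s)"
    and "x \<in> Xs ! r - Xs ! s" "y \<in> Xs ! s - Xs ! r"
    and "of_bool (y \<notin> Ys ! r) + of_bool (x \<notin> Ys ! s) < (of_bool (x \<notin> Ys ! r) + of_bool (y \<notin> Ys ! s) :: nat)"
  shows "seq_dist (swap r s x y Xs) Ys < seq_dist Xs Ys"
proof -
  let ?d = "\<lambda>Xs i. card (Xs ! i - Ys ! i)"
  have "(\<Sum>i\<in>{..<length Xs} - {r, s}. ?d (swap r s x y Xs) i) = (\<Sum>i\<in>{..<length Xs} - {r, s}. ?d Xs i)"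
    by (rule sum.cong) (use assms in \<open>auto simp: nth_swap\<close>)
  moreover have "?d (swap r s x y Xs) r + ?d (swap r s x y Xs) s < ?d Xs r + ?d Xs s"
    using assms card_exchange_diff[of "Xs ! r" x y "Ys ! r"]
      card_exchange_diff[of "Xs ! s" y x "Ys ! s"]
    by (auto simp: nth_swap of_bool_def split: if_splits)
  ultimately show ?thesis
    using sum_split_two[OF assms(1-3), of "?d (swap r s x y Xs)"]
      sum_split_two[OF assms(1-3), of "?d Xs"]
    by (simp add: seq_dist_def)
qed

lemma card_Diff_commute:
  assumes "finite X" "finite Y" "card X = card Y"
  shows "card (X - Y) = card (Y - X)"
  using assms by (simp add: card_Diff_subset_Int Int_commute)

lemma seq_dist_commute:
  assumes "length Xs = length Ys"
    and "\<And>X. X \<in> set Xs \<union> set Ys \<Longrightarrow> finite X \<and> card X = t"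
  shows "seq_dist Xs Ys = seq_dist Ys Xs"
  unfolding seq_dist_def assms(1)
  by (rule sum.cong[OF refl], rule card_Diff_commute) (use assms in auto)

text \<open>The final disjunction places \<open>k\<close> outside \<open>Xs ! r - Ys ! r\<close>:
  its first half calls for an exchange in \<open>Xs\<close>, its second for one in
  \<open>Ys\<close>.\<close>

lemma compatible_obtain_exchange:
  assumes "compatible Xs Ys" "length Xs = length Ys" "Xs \<noteq> Ys"
    and unif: "\<And>X. X \<in> set Xs \<union> set Ys \<Longrightarrow> finite X \<and> card X = t"
  obtains r s i k where "r < length Xs" "s < length Xs" "i \<in> Xs ! r - Ys ! r" "i \<in> Ys ! s - Xs ! s"
    "k \<in> Xs ! s - Ys ! s" "k \<notin> Xs ! r \<or> k \<in> Ys ! r"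
proof -
  have nth_unif: "finite (Xs ! j) \<and> finite (Ys ! j) \<and> card (Xs ! j) = card (Ys ! j)"
    if "j < length Xs" for j
    using that assms(2) unif[of "Xs ! j"] unif[of "Ys ! j"] by auto
  have diff_ne: "Xs ! j - Ys ! j \<noteq> {}" if "j < length Xs" "Xs ! j \<noteq> Ys ! j" for j
    using nth_unif[of j] that card_subset_eq[of "Ys ! j" "Xs ! j"] by auto
  obtain j where "j < length Xs \<and> Xs ! j \<noteq> Ys ! j"
    using assms(2,3) by (auto simp: list_eq_iff_nth_eq)
  then obtain r where r: "r < length Xs" "Xs ! r \<noteq> Ys ! r"
    and least: "\<And>j. j < length Xs \<Longrightarrow> Xs ! j \<noteq> Ys ! j \<Longrightarrow> card (Xs ! r - Ys ! r) \<le> card (Xs ! j - Ys ! j)"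
    using ex_has_least_nat[of "\<lambda>j. j < length Xs \<and> Xs ! j \<noteq> Ys ! j" j "\<lambda>j. card (Xs ! j - Ys ! j)"]
    by blast
  obtain i where i: "i \<in> Xs ! r - Ys ! r" using diff_ne r by blast
  obtain s where s: "s < length Xs" "i \<in> Ys ! s - Xs ! s"
    using compatible_obtain[OF assms(1,2) _ r(1) i] unif by blast
  have "\<not> Xs ! s - Ys ! s \<subseteq> Xs ! r - Ys ! r"
  proof
    assume "Xs ! s - Ys ! s \<subseteq> Xs ! r - Ys ! r"
    \<comment> \<open>The inclusion is proper because of \<open>i\<close>, which is missing from
      \<open>Xs ! s\<close>.\<close>
    then have "Xs ! s - Ys ! s \<subset> Xs ! r - Ys ! r" using i s by blast
    then have "card (Xs ! s - Ys ! s) < card (Xs ! r - Ys ! r)"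
      using nth_unif[OF r(1)] by (intro psubset_card_mono) auto
    moreover have "Xs ! s \<noteq> Ys ! s" using s by blast
    ultimately show False using least[OF s(1)] by simp
  qed
  then show ?thesis using that[OF r(1) s(1) i s(2)] by blast
qed

section \<open>The matroid of \<open>t\<close>-sets on which a map is injective\<close>

definition injective_sets :: "'a set \<Rightarrow> ('a \<Rightarrow> 'b) \<Rightarrow> nat \<Rightarrow> 'a matroid" where
  "injective_sets E c t = \<lparr>ground = E, bases = {U. U \<subseteq> E \<and> inj_on c U \<and> card U = t}\<rparr>"

lemma bases_injective_sets [simp]:
  "bases (injective_sets E c t) = {U. U \<subseteq> E \<and> inj_on c U \<and> card U = t}"
  by (simp add: injective_sets_def)

text \<open>The map \<open>c\<close> takes fewer than \<open>t\<close> values on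
  \<open>A - {x}\<close> but \<open>t\<close> values on \<open>B\<close>, so some \<open>y\<close>
  in \<open>B\<close> brings a fresh value. The set \<open>U\<close> witnesses that there is a
  basis.\<close>

lemma is_matroid_injective_sets:
  assumes "finite E" "U \<subseteq> E" "inj_on c U" "card U = t"
  shows "is_matroid (injective_sets E c t)"
proof -
  let ?M = "injective_sets E c t"
  have "\<exists>y\<in>B - A. (A - {x}) \<union> {y} \<in> bases ?M"
    if bases: "A \<in> bases ?M" "B \<in> bases ?M" and x: "x \<in> A - B" for A B x
  proof -
    have A: "A \<subseteq> E" "inj_on c A" "card A = t" and B: "B \<subseteq> E" "inj_on c B" "card B = t"
      using bases by simp_all
    have fin: "finite A" "finite B"
      using finite_subset[OF A(1) assms(1)] finite_subset[OF B(1) assms(1)] .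
    have "card (c ` (A - {x})) < card (c ` B)"
      using card_image_le[of "A - {x}" c] card_Diff1_less[of A x] card_image[OF B(2)] A(3) B(3) x fin
      by simp
    then have "\<not> c ` B \<subseteq> c ` (A - {x})"
      using fin by (meson card_mono finite_Diff finite_imageI leD)
    then obtain y where y: "y \<in> B" "c y \<notin> c ` (A - {x})" by auto
    \<comment> \<open>The fresh value keeps \<open>y\<close> out of \<open>A - {x}\<close>, and
      \<open>x\<close> itself is not in \<open>B\<close>.\<close>
    have "y \<notin> A" using x y by auto
    moreover have "inj_on c ((A - {x}) \<union> {y})"
      using inj_on_diff[OF A(2), of "{x}"] y(2) by auto
    moreover have "card ((A - {x}) \<union> {y}) = t"
      using x fin A(3) \<open>y \<notin> A\<close> card_Suc_Diff1[of A x] by auto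
    moreover have "(A - {x}) \<union> {y} \<subseteq> E" using A(1) B(1) y(1) by auto
    ultimately show ?thesis using y(1) by (intro bexI[of _ y]) simp_all
  qed
  moreover have "bases ?M \<noteq> {}" "bases ?M \<subseteq> Pow E"
    using assms(2-4) by auto
  moreover have "ground ?M = E"
    by (simp add: injective_sets_def)
  ultimately show ?thesis
    unfolding is_matroid_def using assms(1) by (simp del: bases_injective_sets)
qed

section \<open>Chains of exchanges between sequences of \<open>m\<close> bases\<close>

locale finite_injective_sets =
  fixes E :: "'a set" and c :: "'a \<Rightarrow> 'b" and t m :: nat
  assumes finite_E: "finite E"
begin

abbreviation "M \<equiv> injective_sets E c t"

definition step :: "'a set list \<Rightarrow> 'a set list \<Rightarrow> bool" where
  "step Xs Ys \<longleftrightarrow> basis_seq M m Xs \<and> basis_seq M m Ys \<and> exchange_step 1 M Xs Ys"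

lemma finite_basis: "A \<in> bases M \<Longrightarrow> finite A"
  using finite_subset[OF _ finite_E, of A] by simp

lemma nth_in_bases: "basis_seq M m As \<Longrightarrow> i < m \<Longrightarrow> As ! i \<in> bases M"
  using nth_mem[of i As] by (auto simp: basis_seq_def simp del: bases_injective_sets)

lemma basis_nth:
  assumes "basis_seq M m As" "i < m"
  shows "As ! i \<subseteq> E" "inj_on c (As ! i)" "card (As ! i) = t" "finite (As ! i)"
  using nth_in_bases[OF assms] finite_basis[OF nth_in_bases[OF assms]] by simp_all

lemma exchange_basis:
  assumes A: "A \<in> bases M" and "x \<in> A" "y \<in> E - A" "c y \<notin> c ` (A - {x})"
  shows "(A - {x}) \<union> {y} \<in> bases M"
proof -
  have "card ((A - {x}) \<union> {y}) = t"
    using assms(2,3) finite_basis[OF A] A card_Suc_Diff1[of A x] by simp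
  moreover have "inj_on c ((A - {x}) \<union> {y})"
    using inj_on_diff[of c A "{x}"] A assms(4) by auto
  moreover have "(A - {x}) \<union> {y} \<subseteq> E"
    using A assms(3) by auto
  ultimately show ?thesis by simp
qed

text \<open>Exchanges are also made in the target sequence, so chains must be reversible. The
  reverse exchange trades \<open>x\<close> and \<open>y\<close> back.\<close>

lemma step_sym:
  assumes st: "step As Bs" shows "step Bs As"
proof -
  note assms = st[unfolded step_def]
  have len: "length As = m" "length Bs = m" using assms by (auto simp: basis_seq_def)
  obtain r s x y where rs: "r < s" "s < m" and xy: "x \<in> As ! r" "y \<in> As ! s"
    and b: "(As ! r - {x}) \<union> {y} \<in> bases M" "(As ! s - {y}) \<union> {x} \<in> bases M"
    and Bs: "Bs = swap r s x y As"
    using assms len by (auto simp: exchange_step_def sym_exchange_def swap_def)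
  have A: "As ! r \<in> bases M" "As ! s \<in> bases M"
    using assms rs nth_in_bases[of As r] nth_in_bases[of As s] by simp_all
  have fin: "finite (As ! r)" "finite (As ! s)"
    using A finite_basis by blast+
  \<comment> \<open>Otherwise an insertion would add nothing, leaving a set of \<open>t - 1\<close>
    elements, which is no basis. The case \<open>x = y\<close> remains possible.\<close>
  have ne: "y \<notin> As ! r - {x}" "x \<notin> As ! s - {y}"
    using A b fin xy card_Suc_Diff1[of "As ! r" x] card_Suc_Diff1[of "As ! s" y]
    by (auto simp: insert_absorb)
  have n: "Bs ! r = (As ! r - {x}) \<union> {y}" "Bs ! s = (As ! s - {y}) \<union> {x}"
    using rs len unfolding Bs by (auto simp: nth_swap)
  have undo: "(Bs ! r - {y}) \<union> {x} = As ! r" "(Bs ! s - {x}) \<union> {y} = As ! s"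
    using ne xy unfolding n by blast+
  have "As = swap r s y x Bs"
  proof (rule nth_equalityI)
    fix i assume "i < length As"
    then show "As ! i = swap r s y x Bs ! i"
      using rs len undo nth_swap(3)[of r s As i x y]
      by (cases "i = r"; cases "i = s") (simp_all add: nth_swap Bs[symmetric])
  qed (simp add: len)
  then have "As = Bs[r := (Bs ! r - {y}) \<union> {x}, s := (Bs ! s - {x}) \<union> {y}]"
    by (simp only: swap_def)
  moreover have "y \<in> Bs ! r" "x \<in> Bs ! s" using n by auto
  moreover have "(Bs ! r - {y}) \<union> {x} \<in> bases M" "(Bs ! s - {x}) \<union> {y} \<in> bases M"
    unfolding undo by (fact A)+
  ultimately have "sym_exchange M Bs As"
    unfolding sym_exchange_def using rs len(2) by blast
  then show ?thesis using assms by (simp add: step_def exchange_step_def)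
qed

lemma path_sym:
  assumes "step\<^sup>*\<^sup>* As Bs" shows "step\<^sup>*\<^sup>* Bs As"
  using assms
proof induction
  case (step Xs Ys)
  then show ?case by (meson converse_rtranclp_into_rtranclp step_sym)
qed simp

lemma step_basis_seq: "step As Bs \<Longrightarrow> basis_seq M m Bs"
  by (simp add: step_def)

lemma step_swap:
  assumes As: "basis_seq M m As" and rs: "r \<noteq> s" "r < m" "s < m"
    and x: "x \<in> As ! r - As ! s" "c x \<notin> c ` (As ! s - {y})"
    and y: "y \<in> As ! s - As ! r" "c y \<notin> c ` (As ! r - {x})"
  shows "step As (swap r s x y As)"
proof -
  have len: "length As = m" using As by (simp add: basis_seq_def)
  have A: "As ! r \<in> bases M" "As ! s \<in> bases M"
    using nth_in_bases[OF As] rs by blast+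
  have b: "(As ! r - {x}) \<union> {y} \<in> bases M" "(As ! s - {y}) \<union> {x} \<in> bases M"
    using A x y by (intro exchange_basis; auto)+
  have "basis_seq M m (swap r s x y As)"
    using As b unfolding basis_seq_def swap_def by (simp only: length_list_update set_update_subsetI)
  \<comment> \<open>\<open>sym_exchange\<close> wants the smaller index first;
    \<open>swap_commute\<close> covers the other order.\<close>
  moreover have "sym_exchange M As (swap r s x y As)"
  proof (cases "r < s")
    case True
    then show ?thesis unfolding sym_exchange_def swap_def using rs x y b len by blast
  next
    case False
    then have "s < r" using rs by simp
    then show ?thesis unfolding swap_commute[OF rs(1)]
      unfolding sym_exchange_def swap_def using rs x y b len by blast
  qed
  ultimately show ?thesis using As by (simp add: step_def exchange_step_def)
qed

section \<open>Making the image sequences equal\<close>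

abbreviation "img \<equiv> map (image c)"

text \<open>Injectivity of \<open>c\<close> on a basis lets the image commute with the removal of a
  point.\<close>

lemma img_swap:
  assumes As: "basis_seq M m As" and rs: "r < m" "s < m"
    and "x \<in> As ! r" "y \<in> As ! s"
  shows "img (swap r s x y As) = swap r s (c x) (c y) (img As)"
proof -
  have "c ` (As ! r - {x}) = c ` (As ! r) - {c x}" "c ` (As ! s - {y}) = c ` (As ! s) - {c y}"
    using assms basis_nth(2)[OF As] by (auto simp: inj_on_def)
  then show ?thesis using assms by (simp add: swap_def map_update basis_seq_def)
qed

lemma img_uniform:
  assumes "basis_seq M m As" "X \<in> set (img As)"
  shows "finite X \<and> card X = t"
proof -
  obtain i where "i < m" "X = c ` (As ! i)"
    using assms by (auto simp: basis_seq_def in_set_conv_nth)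
  then show ?thesis using basis_nth[OF assms(1)] by (simp add: card_image)
qed

lemma compatible_img:
  assumes "basis_seq M m As" "basis_seq M m Bs" "compatible As Bs"
  shows "compatible (img As) (img Bs)"
  using assms by (intro compatible_image) (auto simp: basis_seq_def)

text \<open>Moving \<open>i\<close> from entry \<open>r\<close> to entry \<open>s\<close> removes
  one mismatch and creates none. The last condition keeps \<open>k\<close> from undoing this gain:
  its move either removes a mismatch as well or creates none.\<close>

lemma img_exchange:
  assumes As: "basis_seq M m As" and Bs: "basis_seq M m Bs" and rs: "r < m" "s < m"
    and i: "i \<in> img As ! r - img Bs ! r" "i \<in> img Bs ! s - img As ! s"
    and k: "k \<in> img As ! s - img As ! r" "k \<notin> img Bs ! s \<or> k \<in> img Bs ! r"
  obtains As' where "step As As'" "compatible As As'" "seq_dist (img As') (img Bs) < seq_dist (img As) (img Bs)"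
proof -
  have len: "length As = m" "length Bs = m" using As Bs by (auto simp: basis_seq_def)
  obtain x where x: "x \<in> As ! r" "i = c x" using i rs len by auto
  obtain y where y: "y \<in> As ! s" "k = c y" using k rs len by auto
  have ne: "r \<noteq> s" using i by auto
  have notin: "c x \<notin> c ` (As ! s)" "c y \<notin> c ` (As ! r)"
    using i k x y rs len by auto
  then have xy: "x \<in> As ! r - As ! s" "y \<in> As ! s - As ! r" using x y by auto
  have "step As (swap r s x y As)"
    using As ne rs xy notin by (intro step_swap) auto
  moreover have "compatible As (swap r s x y As)"
    using ne rs xy len basis_nth(4)[OF As] by (intro compatible_swap) auto
  moreover have "seq_dist (img (swap r s x y As)) (img Bs) < seq_dist (img As) (img Bs)"
    unfolding img_swap[OF As rs x(1) y(1)]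
    using ne rs i k x y len basis_nth(4)[OF As] by (intro seq_dist_swap) auto
  ultimately show ?thesis using that by blast
qed

lemma path_to_equal_img:
  assumes "basis_seq M m As" "basis_seq M m Bs" "compatible As Bs"
  shows "\<exists>As' Bs'. step\<^sup>*\<^sup>* As As' \<and> step\<^sup>*\<^sup>* Bs Bs' \<and> basis_seq M m As' \<and> basis_seq M m Bs' \<and>
    compatible As' Bs' \<and> img As' = img Bs'"
  using assms
proof (induction "seq_dist (img As) (img Bs)" arbitrary: As Bs rule: less_induct)
  case less
  note As = less.prems(1) and Bs = less.prems(2) and comp = less.prems(3)
  show ?case
  proof (cases "img As = img Bs")
    case True
    then show ?thesis using less.prems by (intro exI[of _ As] exI[of _ Bs]) simp
  next
    case False
    have len: "length As = m" "length Bs = m" using As Bs by (auto simp: basis_seq_def)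
    obtain r s i k where rs: "r < m" "s < m"
      and i: "i \<in> img As ! r - img Bs ! r" "i \<in> img Bs ! s - img As ! s"
      and k: "k \<in> img As ! s - img Bs ! s" "k \<notin> img As ! r \<or> k \<in> img Bs ! r"
    proof (rule compatible_obtain_exchange[OF compatible_img[OF less.prems] _ False])
      show "finite X \<and> card X = t" if "X \<in> set (img As) \<union> set (img Bs)" for X
        using that img_uniform As Bs by blast
    qed (use len in auto)
    show ?thesis
    proof (cases "k \<in> img As ! r")
      case False
      obtain As' where As': "step As As'" "compatible As As'"
        and closer: "seq_dist (img As') (img Bs) < seq_dist (img As) (img Bs)"
        using img_exchange[OF As Bs rs i] k False by blast
      have "compatible As' Bs"
        using As' comp compatible_sym compatible_trans by blast
      then obtain Cs Ds where CD: "step\<^sup>*\<^sup>* As' Cs" "step\<^sup>*\<^sup>* Bs Ds"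
        "basis_seq M m Cs" "basis_seq M m Ds" "compatible Cs Ds" "img Cs = img Ds"
        using less.hyps[OF closer step_basis_seq[OF As'(1)] Bs] by blast
      have "step\<^sup>*\<^sup>* As Cs"
        by (rule converse_rtranclp_into_rtranclp[OF As'(1) CD(1)])
      then show ?thesis
        using CD by (intro exI[of _ Cs] exI[of _ Ds] conjI)
    next
      case True
      \<comment> \<open>An exchange in \<open>Bs\<close> lowers the distance taken from
        \<open>Bs\<close> to \<open>As\<close>, while the induction measures from \<open>As\<close>;
        for \<open>t\<close>-sets the two agree.\<close>
      have comm: "seq_dist (img As) (img Cs) = seq_dist (img Cs) (img As)" if "basis_seq M m Cs" for Cs
        using that len img_uniform[OF As] img_uniform[OF that]
        by (intro seq_dist_commute[of _ _ t]) (auto simp: basis_seq_def simp del: set_map)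
      \<comment> \<open>The roles of the two sequences, and with them \<open>r\<close> and
        \<open>s\<close>, are interchanged.\<close>
      obtain Bs' where Bs': "step Bs Bs'" "compatible Bs Bs'"
        and "seq_dist (img Bs') (img As) < seq_dist (img Bs) (img As)"
        using img_exchange[OF Bs As rs(2,1) i(2,1), of k] True k by blast
      then have closer: "seq_dist (img As) (img Bs') < seq_dist (img As) (img Bs)"
        using comm[OF Bs] comm[OF step_basis_seq[OF Bs'(1)]] by simp
      have "compatible As Bs'"
        using Bs' comp compatible_trans by blast
      then obtain Cs Ds where CD: "step\<^sup>*\<^sup>* As Cs" "step\<^sup>*\<^sup>* Bs' Ds"
        "basis_seq M m Cs" "basis_seq M m Ds" "compatible Cs Ds" "img Cs = img Ds"
        using less.hyps[OF closer As step_basis_seq[OF Bs'(1)]] by blast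
      have "step\<^sup>*\<^sup>* Bs Ds"
        by (rule converse_rtranclp_into_rtranclp[OF Bs'(1) CD(2)])
      then show ?thesis
        using CD by (intro exI[of _ Cs] exI[of _ Ds] conjI)
    qed
  qed
qed

text \<open>If \<open>x\<close> is in \<open>As ! r\<close> but not in \<open>Bs ! r\<close>, equal
  images yield \<open>y\<close> in \<open>Bs ! r\<close> with \<open>c y = c x\<close>, and
  compatibility finds \<open>y\<close> in some \<open>As ! s - Bs ! s\<close>. Trading
  \<open>x\<close> for \<open>y\<close> keeps all images and brings \<open>As\<close> closer to
  \<open>Bs\<close>.\<close>

lemma path_if_equal_img:
  assumes "basis_seq M m As" "basis_seq M m Bs" "compatible As Bs" "img As = img Bs"
  shows "step\<^sup>*\<^sup>* As Bs"
  using assms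
proof (induction "seq_dist As Bs" arbitrary: As rule: less_induct)
  case less
  note As = less.prems(1) and Bs = less.prems(2) and comp = less.prems(3)
  show ?case
  proof (cases "As = Bs")
    case False
    have len: "length As = m" "length Bs = m" using As Bs by (auto simp: basis_seq_def)
    have img_nth: "c ` (As ! i) = c ` (Bs ! i)" if "i < m" for i
      using less.prems(4) that len by (metis nth_map)
    obtain r where r: "r < m" "As ! r \<noteq> Bs ! r"
      using False len by (auto simp: list_eq_iff_nth_eq)
    then have "\<not> As ! r \<subseteq> Bs ! r"
      using card_subset_eq[OF basis_nth(4)[OF Bs r(1)], of "As ! r"]
        basis_nth(3)[OF As r(1)] basis_nth(3)[OF Bs r(1)] by auto
    then obtain x where x: "x \<in> As ! r" "x \<notin> Bs ! r" by blast
    then obtain y where y: "y \<in> Bs ! r" "c y = c x"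
      using img_nth[OF r(1)] imageI[OF x(1), of c] by auto
    have "y \<notin> As ! r" using x y inj_onD[OF basis_nth(2)[OF As r(1)], of x y] by auto
    obtain s where s: "s < m" "y \<in> As ! s - Bs ! s"
    proof (rule compatible_obtain[OF compatible_sym[OF comp]])
      show "finite X" if "X \<in> set Bs \<union> set As" for X
        using that As Bs finite_basis[of X] unfolding basis_seq_def by blast
      show "y \<in> Bs ! r - As ! r" using y(1) \<open>y \<notin> As ! r\<close> by simp
    qed (use len r(1) in auto)
    have ne: "r \<noteq> s" using s y by blast
    have "x \<notin> As ! s" using x y s inj_onD[OF basis_nth(2)[OF As s(1)], of x y] by auto
    then have xy: "x \<in> As ! r - As ! s" "y \<in> As ! s - As ! r"
      using x s \<open>y \<notin> As ! r\<close> by auto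
    let ?As' = "swap r s x y As"
    \<comment> \<open>As \<open>x\<close> and \<open>y\<close> share their value under
      \<open>c\<close>, in each basis only the element being removed has that value.\<close>
    have "c x \<notin> c ` (As ! s - {y})" "c y \<notin> c ` (As ! r - {x})"
      using xy y(2) inj_on_image_mem_iff[OF basis_nth(2)[OF As s(1)], of y "As ! s - {y}"]
        inj_on_image_mem_iff[OF basis_nth(2)[OF As r(1)], of x "As ! r - {x}"] by auto
    then have st: "step As ?As'"
      using As ne r s xy by (intro step_swap) auto
    have "compatible As ?As'"
      using ne r s xy len basis_nth(4)[OF As] by (intro compatible_swap) auto
    then have comp': "compatible ?As' Bs"
      using comp compatible_sym compatible_trans by blast
    have "c x \<in> c ` (As ! r)" "c x \<in> c ` (As ! s)" using xy y(2) by (metis DiffD1 imageI)+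
    then have "img ?As' = img As"
      using img_swap[OF As r(1) s(1), of x y] xy y(2) r s len
      by (simp add: swap_def insert_absorb flip: map_update)
    \<comment> \<open>The mismatches of \<open>x\<close> at \<open>r\<close> and of \<open>y\<close>
      at \<open>s\<close> vanish; at most one arises, that of \<open>x\<close> at
      \<open>s\<close>.\<close>
    moreover have "seq_dist ?As' Bs < seq_dist As Bs"
      using ne r s xy x y len basis_nth(4)[OF As] by (intro seq_dist_swap) auto
    ultimately have "step\<^sup>*\<^sup>* ?As' Bs"
      using less.hyps[of ?As'] step_basis_seq[OF st] comp' Bs less.prems(4) by simp
    with st show ?thesis by (rule converse_rtranclp_into_rtranclp)
  qed simp
qed

lemma path_if_compatible:
  assumes "basis_seq M m As" "basis_seq M m Bs" "compatible As Bs"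
  shows "step\<^sup>*\<^sup>* As Bs"
proof -
  obtain As' Bs' where "step\<^sup>*\<^sup>* As As'" "step\<^sup>*\<^sup>* Bs Bs'" "step\<^sup>*\<^sup>* As' Bs'"
    using path_to_equal_img[OF assms] path_if_equal_img by blast
  then show ?thesis using path_sym by (meson rtranclp_trans)
qed

end

section \<open>From single exchanges to partition matroids\<close>

lemma exchange_step_mono:
  assumes "exchange_step 1 M As Bs" "i \<in> {1, 2, 3}"
  shows "exchange_step i M As Bs"
proof -
  have "sym_exchange M As Bs" using assms(1) by (simp add: exchange_step_def)
  moreover from this have "sym_subset_exchange M As Bs"
    unfolding sym_exchange_def sym_subset_exchange_def
    by (metis empty_subsetI insert_subset)
  ultimately show ?thesis using assms(2) by (auto simp: exchange_step_def)
qed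

lemma satisfies_White_injective_sets:
  assumes "finite E" "is_matroid (injective_sets E c t)"
  shows "satisfies_White (injective_sets E c t)"
proof -
  \<comment> \<open>The length \<open>m\<close> stays free because \<open>TE\<close> quantifies over
    it.\<close>
  interpret finite_injective_sets E c t m for m
    using assms(1) by unfold_locales
  have "(\<lambda>Xs Ys. basis_seq M m Xs \<and> basis_seq M m Ys \<and> exchange_step i M Xs Ys)\<^sup>*\<^sup>* As Bs"
    if "i \<in> {1, 2, 3}" "basis_seq M m As" "basis_seq M m Bs" "compatible As Bs" for i m As Bs
    using path_if_compatible[OF that(2-4)] unfolding step_def[abs_def] by (rule rtranclp_mono[THEN predicate2D, rotated])
      (use exchange_step_mono that(1) in blast)
  then show ?thesis using assms(2) unfolding satisfies_White_def TE_def by blast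
qed

text \<open>The map sends an element of \<open>E\<close> to the singleton of its part, which encodes
  the part without a choice operator.\<close>

lemma partition_matroid_eq_injective_sets:
  assumes "partition_on E P" "finite E"
  shows "partition_matroid E P t = injective_sets E (\<lambda>e. {A \<in> P. e \<in> A}) t"
proof -
  have "(\<forall>A\<in>P. card (U \<inter> A) \<le> 1) \<longleftrightarrow> inj_on (\<lambda>e. {A \<in> P. e \<in> A}) U" if U: "U \<subseteq> E" for U
  proof -
    \<comment> \<open>Finiteness matters here, since \<open>card\<close> of an infinite set is
      0.\<close>
    have le1: "card (U \<inter> A) \<le> 1 \<longleftrightarrow> (\<forall>x\<in>U \<inter> A. \<forall>y\<in>U \<inter> A. x = y)" for A
      using finite_subset[OF U assms(2)] by (simp add: card_le_Suc0_iff_eq)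
    have part: "{A \<in> P. x \<in> A} = {A \<in> P. y \<in> A} \<longleftrightarrow> (\<exists>A\<in>P. x \<in> A \<and> y \<in> A)" (is "?L \<longleftrightarrow> ?R")
      if xy: "x \<in> E" "y \<in> E" for x y
    proof
      assume ?L
      moreover obtain A where "A \<in> P" "x \<in> A"
        using xy(1) partition_onD1[OF assms(1)] by blast
      ultimately show ?R by blast
    next
      assume ?R
      then obtain A where A: "A \<in> P" "x \<in> A" "y \<in> A" by blast
      have "B = A" if "B \<in> P" "x \<in> B \<or> y \<in> B" for B
        using disjointD[OF partition_onD2[OF assms(1)] that(1) A(1)] that(2) A(2,3) by blast
      then show ?L using A by blast
    qed
    show ?thesis
    proof
      assume "\<forall>A\<in>P. card (U \<inter> A) \<le> 1"
      then show "inj_on (\<lambda>e. {A \<in> P. e \<in> A}) U"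
        unfolding le1 using part U by (intro inj_onI) (meson IntI subsetD)
    next
      assume inj: "inj_on (\<lambda>e. {A \<in> P. e \<in> A}) U"
      have "x = y" if "A \<in> P" "x \<in> U \<inter> A" "y \<in> U \<inter> A" for A x y
        using inj_onD[OF inj, of x y] part[of x y] that U by blast
      then show "\<forall>A\<in>P. card (U \<inter> A) \<le> 1" unfolding le1 by blast
    qed
  qed
  then show ?thesis unfolding partition_matroid_def injective_sets_def
    by (simp cong: conj_cong)
qed

text \<open>One element chosen from each of \<open>t\<close> parts gives a basis; disjointness makes
  the chosen elements distinct.\<close>

lemma partial_transversal_exists:
  assumes "partition_on E P" "t \<le> card P"
  obtains U where "U \<subseteq> E" "inj_on (\<lambda>e. {A \<in> P. e \<in> A}) U" "card U = t"
proof -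
  obtain Q where Q: "Q \<subseteq> P" "card Q = t" using obtain_subset_with_card_n[OF assms(2)] by blast
  define f where "f A = (SOME e. e \<in> A)" for A :: "'a set"
  have f: "f A \<in> A" if "A \<in> P" for A
    using that assms(1) unfolding f_def by (metis partition_onD3 some_in_eq)
  have uniq: "{B \<in> P. f A \<in> B} = {A}" if "A \<in> P" for A
    using f[OF that] that assms(1) unfolding partition_on_def disjoint_def by blast
  have "inj_on f Q" using uniq Q(1) by (intro inj_onI) (metis singleton_inject subsetD)
  then have "card (f ` Q) = t" using Q(2) by (simp add: card_image)
  moreover have "f ` Q \<subseteq> E" using f Q(1) partition_onD1[OF assms(1)] by blast
  moreover have "inj_on (\<lambda>e. {A \<in> P. e \<in> A}) (f ` Q)"
    using uniq Q(1) by (intro inj_onI) (auto simp: subset_iff)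
  ultimately show ?thesis using that by blast
qed

theorem corollary3p13:
  fixes E :: "'a set" and P :: "'a set set" and t :: nat
  assumes "finite E" and "partition_on E P" and "t \<le> card P"
  shows "satisfies_White (partition_matroid E P t)"
proof -
  obtain U where "U \<subseteq> E" "inj_on (\<lambda>e. {A \<in> P. e \<in> A}) U" "card U = t"
    using partial_transversal_exists[OF assms(2,3)] .
  then show ?thesis
    unfolding partition_matroid_eq_injective_sets[OF assms(2,1)]
    using assms(1) by (intro satisfies_White_injective_sets is_matroid_injective_sets)
qed

end
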